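(* There is an absolute constant $c>0$ such that the following holds. Let $N,M\ge 1$, $\varepsilon>0$, let $\boldsymbol x^1,\boldsymbol x^2\in\mathbb{R}^N$ and $\boldsymbol y^1,\boldsymbol y^2\in\mathbb{R}^M$ be vectors with strictly increasing entries, and let $K\in\mathbb{R}^{NM\times NM}$ be the two-dimensional kernel matrix of the grids $\boldsymbol x^1\times\boldsymbol y^1$ and $\boldsymbol x^2\times\boldsymbol y^2$. Let $$K_x=\bigl[e^{-|x^1_k-x^2_l|/\varepsilon}\bigr]_{k,l=1}^N\in\mathbb{R}^{N\times N},\qquad K_y=\bigl[e^{-|y^1_i-y^2_j|/\varepsilon}\bigr]_{i,j=1}^M\in\mathbb{R}^{M\times M}.$$ Then $K=K_y\otimes K_x$, and for all $\Psi,\Phi\in\mathbb{R}^{N\times M}$, with $\boldsymbol\psi=\operatorname{vec}(\Psi)$ and $\boldsymbol\phi=\operatorname{vec}(\Phi)$, $$K\boldsymbol\psi=\operatorname{vec}\bigl((K_x\Psi)K_y^\top\bigr),\qquad K^\top\boldsymbol\phi=\operatorname{vec}\bigl((K_x^\top\Phi)K_y\bigr).$$ Moreover, after a precomputation depending only on $\boldsymbol x^1,\boldsymbol x^2,\boldsymbol y^1,\boldsymbol y^2,\varepsilon$, the products $K\boldsymbol\psi$ and $K^\top\boldsymbol\phi$ can each be computed exactly with at most $c\,NM$ real arithmetic operations for every $\boldsymbol\psi,\boldsymbol\phi\in\mathbb{R}^{NM}$. Consequently, each Sinkhorn iteration $$\boldsymbol\psi\leftarrow\operatorname{vec}(\boldsymbol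 v)\oslash(K^\top\boldsymbol\phi),\qquad \boldsymbol\phi\leftarrow\operatorname{vec}(\boldsymbol u)\oslash(K\boldsymbol\psi)$$ for $\boldsymbol u,\boldsymbol v\in\mathbb{R}^{N\times M}$ can be performed in $O(NM)$ arithmetic operations, i.e. linearly in the number of grid points.
   Context: The grid points of $\boldsymbol x^a\times\boldsymbol y^a$ ($a=1,2$) are the points $(x^a_k,y^a_i)$, $1\le k\le N$, $1\le i\le M$, listed in column-major order (the index $k$ varies fastest), so that $(x^a_k,y^a_i)$ has position $(i-1)N+k$. The two-dimensional kernel matrix $K\in\mathbb{R}^{NM\times NM}$ has as its entry in row $(i-1)N+k$ and column $(j-1)N+l$ the number $e^{-(|x^1_k-x^2_l|+|y^1_i-y^2_j|)/\varepsilon}$. $\operatorname{vec}(\cdot)$ is the column-major vectorization of a matrix (stacking its columns), $\otimes$ is the Kronecker product, and $\oslash$ is entrywise division. In the Sinkhorn iteration, $\boldsymbol u,\boldsymbol v$ are probability arrays on the two grids and the iterates $\boldsymbol\phi,\boldsymbol\psi\in\mathbb{R}^{NM}$ are assumed such that the divisions are defined (e.g. positive entries). *)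

theory Defs
  imports Complex_Main "Jordan_Normal_Form.Matrix"
begin

text \<open>All indices are 0-based: the 1-based position \<open>(i-1)N+k\<close> becomes \<open>i * N + k\<close> with
  \<open>k < N\<close>, so the two coordinates of a position \<open>p\<close> are \<open>k = p mod N\<close> and \<open>i = p div N\<close>.\<close>

definition vectorize :: "'a mat \<Rightarrow> 'a vec" where
  "vectorize A = vec (dim_row A * dim_col A) (\<lambda>p. A $$ (p mod dim_row A, p div dim_row A))"

definition kronecker :: "'a::times mat \<Rightarrow> 'a mat \<Rightarrow> 'a mat" (infixl "\<otimes>\<^sub>K" 70) where
  "A \<otimes>\<^sub>K B = mat (dim_row A * dim_row B) (dim_col A * dim_col B)
     (\<lambda>(p, q). A $$ (p div dim_row B, q div dim_col B) * B $$ (p mod dim_row B, q mod dim_col B))"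

definition vec_divide :: "real vec \<Rightarrow> real vec \<Rightarrow> real vec" (infixl "\<oslash>" 70) where
  "a \<oslash> b = vec (dim_vec b) (\<lambda>p. a $ p / b $ p)"

definition strictly_increasing :: "real vec \<Rightarrow> bool" where
  "strictly_increasing x \<longleftrightarrow> strict_mono_on {..<dim_vec x} (\<lambda>k. x $ k)"

definition kernel_1d :: "real \<Rightarrow> real vec \<Rightarrow> real vec \<Rightarrow> real mat" where
  "kernel_1d \<epsilon> x1 x2 = mat (dim_vec x1) (dim_vec x2) (\<lambda>(k, l). exp (- \<bar>x1 $ k - x2 $ l\<bar> / \<epsilon>))"

definition kernel_2d :: "real \<Rightarrow> real vec \<Rightarrow> real vec \<Rightarrow> real vec \<Rightarrow> real vec \<Rightarrow> real mat" where
  "kernel_2d \<epsilon> x1 y1 x2 y2 =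
     mat (dim_vec x1 * dim_vec y1) (dim_vec x2 * dim_vec y2)
       (\<lambda>(p, q). exp (- (\<bar>x1 $ (p mod dim_vec x1) - x2 $ (q mod dim_vec x2)\<bar>
                       + \<bar>y1 $ (p div dim_vec x1) - y2 $ (q div dim_vec x2)\<bar>) / \<epsilon>))"

definition sinkhorn_psi :: "real mat \<Rightarrow> real mat \<Rightarrow> real vec \<Rightarrow> real vec" where
  "sinkhorn_psi K v \<phi> = vectorize v \<oslash> (K\<^sup>T *\<^sub>v \<phi>)"

definition sinkhorn_phi :: "real mat \<Rightarrow> real mat \<Rightarrow> real vec \<Rightarrow> real vec" where
  "sinkhorn_phi K u \<psi> = vectorize u \<oslash> (K *\<^sub>v \<psi>)"

text \<open>No entry of a denominator vanishes during the iteration started from \<open>\<phi>\<close>.\<close>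

definition sinkhorn_defined :: "real mat \<Rightarrow> real mat \<Rightarrow> real vec \<Rightarrow> bool" where
  "sinkhorn_defined K v \<phi> \<longleftrightarrow>
     (\<forall>p < dim_col K. (K\<^sup>T *\<^sub>v \<phi>) $ p \<noteq> 0) \<and>
     (\<forall>p < dim_row K. (K *\<^sub>v sinkhorn_psi K v \<phi>) $ p \<noteq> 0)"

text \<open>The memory is the list of all values known so far: first the inputs, then the result of
  each executed instruction, appended at the end. An operand is a memory cell or a constant; the
  constants (and the choice of instructions) are what a precomputation may supply. Every
  instruction is one arithmetic operation. Access to a cell that does not exist and division by
  zero are undefined, so a program cannot exploit the convention \<open>a / 0 = 0\<close>. Copying values
  to the output is not counted.\<close>

datatype arith_op = Plus | Minus | Times | Divide

datatype operand = Cell nat | Const real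

datatype instr = Instr arith_op operand operand

datatype slp = SLP (slp_instrs: "instr list") (slp_outputs: "operand list")

fun arith_val :: "arith_op \<Rightarrow> real \<Rightarrow> real \<Rightarrow> real option" where
  "arith_val Plus a b = Some (a + b)"
| "arith_val Minus a b = Some (a - b)"
| "arith_val Times a b = Some (a * b)"
| "arith_val Divide a b = (if b = 0 then None else Some (a / b))"

fun operand_val :: "real list \<Rightarrow> operand \<Rightarrow> real option" where
  "operand_val mem (Cell n) = (if n < length mem then Some (mem ! n) else None)"
| "operand_val mem (Const a) = Some a"

fun exec_instr :: "instr \<Rightarrow> real list \<Rightarrow> real list option" where
  "exec_instr (Instr f s t) mem =
     Option.bind (operand_val mem s) (\<lambda>a.
     Option.bind (operand_val mem t) (\<lambda>b.
     map_option (\<lambda>r. mem @ [r]) (arith_val f a b)))"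

fun exec_instrs :: "instr list \<Rightarrow> real list \<Rightarrow> real list option" where
  "exec_instrs [] mem = Some mem"
| "exec_instrs (i # is) mem = Option.bind (exec_instr i mem) (exec_instrs is)"

fun operand_vals :: "real list \<Rightarrow> operand list \<Rightarrow> real list option" where
  "operand_vals mem [] = Some []"
| "operand_vals mem (s # ss) =
     Option.bind (operand_val mem s) (\<lambda>a. map_option ((#) a) (operand_vals mem ss))"

definition slp_eval :: "slp \<Rightarrow> real list \<Rightarrow> real list option" where
  "slp_eval P inputs =
     Option.bind (exec_instrs (slp_instrs P) inputs) (\<lambda>mem. operand_vals mem (slp_outputs P))"

definition slp_cost :: "slp \<Rightarrow> nat" where
  "slp_cost P = length (slp_instrs P)"

end

theory Submission
  imports Defs
begin

text \<open>For increasing \<open>z\<close>, the indices \<open>l\<close> with \<open>z l \<le> t\<close> form an initial segment \<open>{..<m}\<close>, and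
  \<open>exp (- \<bar>t - z l\<bar> / \<epsilon>)\<close> factors as \<open>exp (- t / \<epsilon>) * exp (z l / \<epsilon>)\<close> on this segment and as
  \<open>exp (t / \<epsilon>) * exp (- z l / \<epsilon>)\<close> outside of it. Hence a product with a one-dimensional kernel
  matrix can be read off two sequences of prefix sums, and costs at most \<open>8 n\<close> operations. The
  two-dimensional kernel is a Kronecker product, so the product with it amounts to one-dimensional
  products with all columns and then with all rows: \<open>16 N M\<close> operations.\<close>

section \<open>Straight-line programs\<close>

lemma exec_instrs_append:
  "exec_instrs (xs @ ys) mem = Option.bind (exec_instrs xs mem) (exec_instrs ys)"
proof (induction xs arbitrary: mem)
  case (Cons a xs)
  then show ?case by (cases "exec_instr a mem") auto
qed simp

text \<open>Results are only ever appended to the memory, so an existing cell keeps its number and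
  its value. Operands found for earlier quantities thus survive every later instruction.\<close>

lemma operand_val_append:
  "operand_val mem s = Some a \<Longrightarrow> operand_val (mem @ mem') s = Some a"
  by (cases s) (auto simp: nth_append split: if_splits)

lemma operand_vals_Some:
  assumes "list_all2 (\<lambda>s a. operand_val mem s = Some a) ss as"
  shows "operand_vals mem ss = Some as"
  using assms by (induction rule: list_all2_induct) auto

section \<open>Quantities made available by a program, and the cost of deriving new ones\<close>

context
  fixes X :: "'i set" and inp :: "'i \<Rightarrow> real list"
begin

text \<open>The inputs are a family indexed by \<open>X\<close>; at most \<open>t\<close> instructions, chosen independently of
  the index, make all functions of the index in \<open>S\<close> available as operands.\<close>

definition slp_reaches :: "('i \<Rightarrow> real) set \<Rightarrow> nat \<Rightarrow> bool" where
  "slp_reaches S t \<longleftrightarrow> (\<exists>is mem L. length is \<le> t \<and>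
     (\<forall>i\<in>X. exec_instrs is (inp i) = Some (mem i) \<and> length (mem i) = L) \<and>
     (\<forall>f\<in>S. \<exists>s. \<forall>i\<in>X. operand_val (mem i) s = Some (f i)))"

text \<open>The quantifier over \<open>S\<close> acts as a frame rule: whatever was available before
  stays available, and the cost is counted relative to any starting point. This makes costs additive
  under composition.\<close>

definition slp_derives :: "('i \<Rightarrow> real) set \<Rightarrow> ('i \<Rightarrow> real) set \<Rightarrow> nat \<Rightarrow> bool" where
  "slp_derives F G t \<longleftrightarrow>
     (\<forall>S t0. F \<subseteq> S \<longrightarrow> slp_reaches S t0 \<longrightarrow> slp_reaches (S \<union> G) (t0 + t))"

lemma slp_reaches_inputs:
  assumes "\<And>i. i \<in> X \<Longrightarrow> length (inp i) = L"
  shows "slp_reaches ((\<lambda>p i. inp i ! p) ` {..<L}) 0"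
proof -
  have "\<exists>s. \<forall>i\<in>X. operand_val (inp i) s = Some (f i)"
    if "f \<in> (\<lambda>p i. inp i ! p) ` {..<L}" for f
  proof -
    from that obtain p where "p < L" "f = (\<lambda>i. inp i ! p)" by auto
    then show ?thesis using assms by (intro exI[of _ "Cell p"]) simp
  qed
  then show ?thesis
    unfolding slp_reaches_def using assms
    by (intro exI[of _ "[]"] exI[of _ inp] exI[of _ L]) simp
qed

text \<open>An operand has to be correct for indices in \<open>X\<close> only. So the functions
  count only through their restrictions to \<open>X\<close>, which matters because dimensions, and
  with them vector entries, are controlled only there.\<close>

lemma slp_reaches_cong:
  assumes "slp_reaches S t" "\<And>g. g \<in> S' \<Longrightarrow> \<exists>f\<in>S. \<forall>i\<in>X. g i = f i"
  shows "slp_reaches S' t"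
proof -
  obtain "is" mem L where *: "length is \<le> t"
    "\<forall>i\<in>X. exec_instrs is (inp i) = Some (mem i) \<and> length (mem i) = L"
    "\<forall>f\<in>S. \<exists>s. \<forall>i\<in>X. operand_val (mem i) s = Some (f i)"
    using assms(1) unfolding slp_reaches_def by blast
  have "\<exists>s. \<forall>i\<in>X. operand_val (mem i) s = Some (g i)" if "g \<in> S'" for g
    using assms(2)[OF that] *(3) by force
  then show ?thesis unfolding slp_reaches_def using *(1,2) by blast
qed

lemma slp_reaches_subset:
  "slp_reaches S t \<Longrightarrow> S' \<subseteq> S \<Longrightarrow> slp_reaches S' t"
  by (rule slp_reaches_cong) auto

text \<open>This turns reachability back into a program: one operand is chosen for each listed
  function, the same for all indices, and the chosen operands become the outputs, whose copying is
  free.\<close>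

lemma slp_reaches_eval:
  assumes "slp_reaches S t" "set fs \<subseteq> S"
  obtains P where "slp_cost P \<le> t"
    "\<And>i. i \<in> X \<Longrightarrow> slp_eval P (inp i) = Some (map (\<lambda>f. f i) fs)"
proof -
  obtain "is" mem L where *: "length is \<le> t"
    "\<forall>i\<in>X. exec_instrs is (inp i) = Some (mem i) \<and> length (mem i) = L"
    "\<forall>f\<in>S. \<exists>s. \<forall>i\<in>X. operand_val (mem i) s = Some (f i)"
    using assms(1) unfolding slp_reaches_def by blast
  obtain \<sigma> where \<sigma>: "\<forall>f\<in>S. \<forall>i\<in>X. operand_val (mem i) (\<sigma> f) = Some (f i)"
    using *(3) by metis
  have "operand_vals (mem i) (map \<sigma> fs) = Some (map (\<lambda>f. f i) fs)" if "i \<in> X" for i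
    using \<sigma> that assms(2)
    by (intro operand_vals_Some) (auto simp: list_all2_map1 list_all2_map2 intro!: list.rel_refl_strong)
  then show ?thesis
    using * by (intro that[of "SLP is (map \<sigma> fs)"]) (auto simp: slp_cost_def slp_eval_def)
qed

lemma slp_derives_op:
  assumes "\<And>i. i \<in> X \<Longrightarrow> arith_val opn (f i) (g i) = Some (h i)"
  shows "slp_derives {f, g} {h} 1"
  unfolding slp_derives_def
proof (intro allI impI)
  fix S t0
  assume fg: "{f, g} \<subseteq> S" and "slp_reaches S t0"
  then obtain "is" mem L where *: "length is \<le> t0"
    "\<forall>i\<in>X. exec_instrs is (inp i) = Some (mem i) \<and> length (mem i) = L"
    "\<forall>f\<in>S. \<exists>s. \<forall>i\<in>X. operand_val (mem i) s = Some (f i)"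
    unfolding slp_reaches_def by blast
  obtain s where s: "\<forall>i\<in>X. operand_val (mem i) s = Some (f i)" using *(3) fg by auto
  obtain s' where s': "\<forall>i\<in>X. operand_val (mem i) s' = Some (g i)" using *(3) fg by auto
  have exec: "\<forall>i\<in>X. exec_instrs (is @ [Instr opn s s']) (inp i) = Some (mem i @ [h i])
      \<and> length (mem i @ [h i]) = Suc L"
    using *(2) s s' assms by (simp add: exec_instrs_append)
  have "\<exists>s. \<forall>i\<in>X. operand_val (mem i @ [h i]) s = Some (k i)" if "k \<in> S \<union> {h}" for k
  proof (cases "k \<in> S")
    case True
    then show ?thesis using *(3) operand_val_append by meson
  next
    case False
    \<comment> \<open>The memories have the common length \<open>L\<close> for all indices, so the
      new value lands in the same cell for each of them.\<close>
    then show ?thesis using that *(2) by (intro exI[of _ "Cell L"]) auto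
  qed
  then show "slp_reaches (S \<union> {h}) (t0 + 1)"
    unfolding slp_reaches_def using exec *(1)
    by (intro exI[of _ "is @ [Instr opn s s']"] exI[of _ "\<lambda>i. mem i @ [h i]"] exI[of _ "Suc L"]) auto
qed

lemma slp_derives_const: "slp_derives {} {\<lambda>i. a} 0"
  unfolding slp_derives_def
proof (intro allI impI)
  fix S t0
  assume "slp_reaches S t0"
  then obtain "is" mem L where *: "length is \<le> t0"
    "\<forall>i\<in>X. exec_instrs is (inp i) = Some (mem i) \<and> length (mem i) = L"
    "\<forall>f\<in>S. \<exists>s. \<forall>i\<in>X. operand_val (mem i) s = Some (f i)"
    unfolding slp_reaches_def by blast
  have "\<exists>s. \<forall>i\<in>X. operand_val (mem i) s = Some (k i)" if "k \<in> S \<union> {\<lambda>i. a}" for k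
    using that *(3) by (auto intro: exI[of _ "Const a"])
  then show "slp_reaches (S \<union> {\<lambda>i. a}) (t0 + 0)"
    unfolding slp_reaches_def add_0_right using *(1,2) by blast
qed

section \<open>Combining derivations\<close>

lemma slp_derives_refl: "slp_derives F F 0"
  unfolding slp_derives_def by (simp add: Un_absorb2)

text \<open>Nothing is forgotten: the second derivation may draw on the original quantities as well
  as on the intermediate ones, and both remain for later use.\<close>

lemma slp_derives_comp:
  assumes "slp_derives F G t" "slp_derives G' H u" "G' \<subseteq> F \<union> G"
  shows "slp_derives F (G \<union> H) (t + u)"
  unfolding slp_derives_def
proof (intro allI impI)
  fix S t0
  assume S: "F \<subseteq> S" "slp_reaches S t0"
  then have "slp_reaches (S \<union> G) (t0 + t)" using assms(1) unfolding slp_derives_def by blast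
  moreover have "G' \<subseteq> S \<union> G" using assms(3) S by blast
  ultimately have "slp_reaches (S \<union> G \<union> H) (t0 + t + u)"
    using assms(2) unfolding slp_derives_def by blast
  then show "slp_reaches (S \<union> (G \<union> H)) (t0 + (t + u))" by (simp add: Un_assoc add.assoc)
qed

lemma slp_derives_mono:
  assumes "slp_derives F G t" "F \<subseteq> F'" "G' \<subseteq> G"
  shows "slp_derives F' G' t"
  unfolding slp_derives_def
proof (intro allI impI)
  fix S t0
  assume "F' \<subseteq> S" "slp_reaches S t0"
  then have "slp_reaches (S \<union> G) (t0 + t)" using assms unfolding slp_derives_def by blast
  then show "slp_reaches (S \<union> G') (t0 + t)" by (rule slp_reaches_subset) (use assms in blast)
qed

lemma slp_derives_trans:
  assumes "slp_derives F G t" "slp_derives G H u"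
  shows "slp_derives F H (t + u)"
  by (rule slp_derives_mono[OF slp_derives_comp[OF assms]]) auto

lemma slp_derives_cong:
  assumes "slp_derives F G t"
    and "\<And>f. f \<in> F \<Longrightarrow> \<exists>f'\<in>F'. \<forall>i\<in>X. f i = f' i"
    and "\<And>g. g \<in> G' \<Longrightarrow> \<exists>g'\<in>G. \<forall>i\<in>X. g i = g' i"
  shows "slp_derives F' G' t"
  unfolding slp_derives_def
proof (intro allI impI)
  fix S t0
  assume S: "F' \<subseteq> S" "slp_reaches S t0"
  have "slp_reaches (S \<union> F) t0"
    by (rule slp_reaches_cong[OF S(2)]) (use assms(2) S(1) in blast)
  then have "slp_reaches (S \<union> F \<union> G) (t0 + t)"
    using assms(1) unfolding slp_derives_def by blast
  then show "slp_reaches (S \<union> G') (t0 + t)"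
    by (rule slp_reaches_cong) (use assms(3) in blast)
qed

lemma slp_derives_UN:
  assumes "\<And>k. k < n \<Longrightarrow> slp_derives F (G k) t"
  shows "slp_derives F (\<Union>k<n. G k) (n * t)"
  using assms
proof (induction n)
  case 0
  then show ?case using slp_derives_mono[OF slp_derives_refl, of "{}" F "{}"] by simp
next
  case (Suc n)
  have "slp_derives F ((\<Union>k<n. G k) \<union> G n) (n * t + t)"
    by (rule slp_derives_comp[where G' = F]) (use Suc in auto)
  moreover have "(\<Union>k<Suc n. G k) = (\<Union>k<n. G k) \<union> G n" by (auto simp: lessThan_Suc)
  ultimately show ?case by (simp add: add.commute)
qed

lemma slp_derives_image:
  assumes "\<And>k. k < n \<Longrightarrow> slp_derives F {g k} t"
  shows "slp_derives F (g ` {..<n}) (n * t)"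
  using slp_derives_UN[OF assms] by (simp add: UNION_singleton_eq_range)

lemma slp_derives_op_const:
  assumes "\<And>i. i \<in> X \<Longrightarrow> arith_val opn a (f i) = Some (h i)"
  shows "slp_derives {f} {h} 1"
proof -
  have "slp_derives {f} {\<lambda>i. a} 0" by (rule slp_derives_mono[OF slp_derives_const]) auto
  then have "slp_derives {f} ({\<lambda>i. a} \<union> {h}) (0 + 1)"
    by (rule slp_derives_comp[OF _ slp_derives_op[OF assms]]) auto
  then have "slp_derives {f} {h} (0 + 1)" by (rule slp_derives_mono) auto
  then show ?thesis by simp
qed

section \<open>Products with a one-dimensional kernel in linear time\<close>

text \<open>Each prefix sum arises from the preceding one by a multiplication with the constant
  \<open>a n\<close> and an addition; the empty sum is the constant 0 and costs nothing.\<close>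

lemma slp_derives_prefix_sums:
  "slp_derives (f ` {..<n}) ((\<lambda>m i. \<Sum>l<m. a l * f l i) ` {..n}) (2 * n)"
proof (induction n)
  case 0
  then show ?case using slp_derives_const[of 0] by simp
next
  case (Suc n)
  let ?g = "\<lambda>m i. \<Sum>l<m. a l * f l i"
  have scale: "slp_derives {f n} {\<lambda>i. a n * f n i} 1"
    by (rule slp_derives_op_const[where opn = Times and a = "a n"]) simp
  have add: "slp_derives {?g n, \<lambda>i. a n * f n i} {?g (Suc n)} 1"
    by (rule slp_derives_op[where opn = Plus]) simp
  have "slp_derives {f n, ?g n} ({\<lambda>i. a n * f n i} \<union> {?g (Suc n)}) (1 + 1)"
    by (rule slp_derives_comp[OF slp_derives_mono[OF scale] add]) auto
  then have "slp_derives (f ` {..<Suc n})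
      (?g ` {..n} \<union> ({\<lambda>i. a n * f n i} \<union> {?g (Suc n)})) (2 * n + (1 + 1))"
    by (rule slp_derives_comp[rotated]) (auto intro: slp_derives_mono[OF Suc.IH])
  then have "slp_derives (f ` {..<Suc n}) (?g ` {..Suc n}) (2 * n + (1 + 1))"
    by (rule slp_derives_mono) (auto simp: atMost_Suc)
  then show ?case by simp
qed

text \<open>In an increasing sequence the condition \<open>z l \<le> t\<close> passes from an index
  to all smaller ones, so it is described by a single cut \<open>m\<close>.\<close>

lemma increasing_le_initial_segment:
  fixes z :: "nat \<Rightarrow> real"
  assumes "strict_mono_on {..<n} z"
  obtains m where "m \<le> n" "\<And>l. l < n \<Longrightarrow> z l \<le> t \<longleftrightarrow> l < m"
proof -
  have "\<exists>m\<le>n. \<forall>l<n. z l \<le> t \<longleftrightarrow> l < m"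
    using assms
  proof (induction n)
    case (Suc n)
    show ?case
    proof (cases "z n \<le> t")
      case True
      have "z l \<le> t" if "l < Suc n" for l
        using strict_mono_onD[OF Suc.prems, of l n] that True by (cases "l = n") auto
      then show ?thesis by auto
    next
      case False
      have "strict_mono_on {..<n} z" using Suc.prems by (auto simp: strict_mono_on_def)
      then obtain m where "m \<le> n" "\<forall>l<n. z l \<le> t \<longleftrightarrow> l < m" using Suc.IH by blast
      then show ?thesis using False by (intro exI[of _ m]) (auto simp: less_Suc_eq)
    qed
  qed simp
  then show ?thesis using that by blast
qed

text \<open>The absolute value is \<open>t - z l\<close> below the cut and \<open>z l - t\<close>
  from the cut on, so the exponential separates into a factor in \<open>t\<close> and a factor in
  \<open>z l\<close>. The tail from \<open>m\<close> is written as a difference of two prefix sums,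
  so that prefix sums alone suffice.\<close>

lemma exp_abs_sum_split:
  fixes t \<epsilon> :: real and m n :: nat
  assumes "m \<le> n" "\<And>l. l < n \<Longrightarrow> z l \<le> t \<longleftrightarrow> l < m"
  shows "(\<Sum>l<n. exp (- \<bar>t - z l\<bar> / \<epsilon>) * b l) =
    exp (- t / \<epsilon>) * (\<Sum>l<m. exp (z l / \<epsilon>) * b l) +
    exp (t / \<epsilon>) * ((\<Sum>l<n. exp (- z l / \<epsilon>) * b l) - (\<Sum>l<m. exp (- z l / \<epsilon>) * b l))"
proof -
  have split: "sum g {..<n} = sum g {..<m} + sum g {m..<n}" for g :: "nat \<Rightarrow> real"
    using assms(1) by (metis atLeast0LessThan le0 sum.atLeastLessThan_concat)
  have low: "exp (- \<bar>t - z l\<bar> / \<epsilon>) = exp (- t / \<epsilon>) * exp (z l / \<epsilon>)" if "l < m" for l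
    using assms that by (simp add: exp_add[symmetric] diff_divide_distrib)
  have high: "exp (- \<bar>t - z l\<bar> / \<epsilon>) = exp (t / \<epsilon>) * exp (- z l / \<epsilon>)" if "m \<le> l" "l < n" for l
    using assms(2)[of l] that by (simp add: exp_add[symmetric] diff_divide_distrib)
  have "(\<Sum>l<m. exp (- \<bar>t - z l\<bar> / \<epsilon>) * b l) = exp (- t / \<epsilon>) * (\<Sum>l<m. exp (z l / \<epsilon>) * b l)"
    unfolding sum_distrib_left by (intro sum.cong refl) (simp only: low lessThan_iff mult.assoc)
  moreover have "(\<Sum>l=m..<n. exp (- \<bar>t - z l\<bar> / \<epsilon>) * b l) =
      exp (t / \<epsilon>) * (\<Sum>l=m..<n. exp (- z l / \<epsilon>) * b l)"
    unfolding sum_distrib_left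
    by (intro sum.cong refl) (simp only: high atLeastLessThan_iff mult.assoc)
  ultimately show ?thesis
    unfolding split[of "\<lambda>l. exp (- z l / \<epsilon>) * b l"] split[of "\<lambda>l. exp (- \<bar>t - z l\<bar> / \<epsilon>) * b l"]
    by simp
qed

text \<open>Two families of weighted prefix sums cost \<open>2 * n\<close> operations each, and
  every one of the \<open>n\<close> entries then takes four more: two scalings, a subtraction and an
  addition. All exponentials are constants of the program.\<close>

lemma slp_derives_kernel_1d:
  fixes x z :: "nat \<Rightarrow> real"
  assumes "strict_mono_on {..<n} z"
  shows "slp_derives (f ` {..<n})
    ((\<lambda>k i. \<Sum>l<n. exp (- \<bar>x k - z l\<bar> / \<epsilon>) * f l i) ` {..<n}) (8 * n)"
proof -
  define A where "A = (\<lambda>m i. \<Sum>l<m. exp (z l / \<epsilon>) * f l i)"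
  define B where "B = (\<lambda>m i. \<Sum>l<m. exp (- z l / \<epsilon>) * f l i)"
  let ?AB = "A ` {..n} \<union> B ` {..n}"
  have AB: "slp_derives (f ` {..<n}) ?AB (2 * n + 2 * n)"
    unfolding A_def B_def
    by (rule slp_derives_comp[OF slp_derives_prefix_sums slp_derives_prefix_sums]) simp
  have "slp_derives ?AB {\<lambda>i. \<Sum>l<n. exp (- \<bar>x k - z l\<bar> / \<epsilon>) * f l i} 4" for k
  proof -
    \<comment> \<open>The cut depends on \<open>k\<close> and the grids but not on the input index
      \<open>i\<close>, so locating it belongs to the precomputation and costs no
      instruction.\<close>
    obtain m where m: "m \<le> n" "\<And>l. l < n \<Longrightarrow> z l \<le> x k \<longleftrightarrow> l < m"
      using increasing_le_initial_segment[OF assms] by blast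
    let ?a = "\<lambda>i. exp (- x k / \<epsilon>) * A m i" and ?d = "\<lambda>i. B n i - B m i"
    let ?b = "\<lambda>i. exp (x k / \<epsilon>) * ?d i"
    have "slp_derives ?AB {?a} 1"
      by (rule slp_derives_mono[OF slp_derives_op_const[where opn = Times
            and a = "exp (- x k / \<epsilon>)" and f = "A m"]])
        (use m in auto)
    moreover have "slp_derives {B n, B m} {?d} 1"
      by (rule slp_derives_op[where opn = Minus]) simp
    ultimately have "slp_derives ?AB ({?a} \<union> {?d}) (1 + 1)"
      by (rule slp_derives_comp) (use m in auto)
    moreover have "slp_derives {?d} {?b} 1"
      by (rule slp_derives_op_const[where opn = Times and a = "exp (x k / \<epsilon>)"]) simp
    ultimately have "slp_derives ?AB ({?a} \<union> {?d} \<union> {?b}) (1 + 1 + 1)"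
      by (rule slp_derives_comp) auto
    moreover have "slp_derives {?a, ?b} {\<lambda>i. ?a i + ?b i} 1"
      by (rule slp_derives_op[where opn = Plus]) simp
    ultimately have "slp_derives ?AB ({?a} \<union> {?d} \<union> {?b} \<union> {\<lambda>i. ?a i + ?b i}) (1 + 1 + 1 + 1)"
      by (rule slp_derives_comp) auto
    then have "slp_derives ?AB {\<lambda>i. ?a i + ?b i} (1 + 1 + 1 + 1)"
      by (rule slp_derives_mono) auto
    moreover have "(\<lambda>i. \<Sum>l<n. exp (- \<bar>x k - z l\<bar> / \<epsilon>) * f l i) = (\<lambda>i. ?a i + ?b i)"
      unfolding A_def B_def by (intro ext exp_abs_sum_split m)
    ultimately show ?thesis by (simp add: numeral_eq_Suc)
  qed
  then have "slp_derives ?AB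
      ((\<lambda>k i. \<Sum>l<n. exp (- \<bar>x k - z l\<bar> / \<epsilon>) * f l i) ` {..<n}) (n * 4)"
    by (rule slp_derives_image)
  from slp_derives_trans[OF AB this] show ?thesis by (simp add: mult.commute)
qed

section \<open>Products along columns and then along rows\<close>

text \<open>The inner sums \<open>T k j\<close> do not depend on \<open>h\<close> and are computed
  once: \<open>M\<close> one-dimensional products of length \<open>N\<close>. The outer sums are
  \<open>N\<close> products of length \<open>M\<close>, which gives
  \<open>M * (8 * N) + N * (8 * M)\<close>.\<close>

lemma slp_derives_kernel_2d_entries:
  fixes x z y w :: "nat \<Rightarrow> real"
  assumes z: "strict_mono_on {..<N} z" and w: "strict_mono_on {..<M} w"
  shows "slp_derives (\<Union>j<M. (\<lambda>l. f l j) ` {..<N})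
    (\<Union>k<N. (\<lambda>h i. \<Sum>j<M. exp (- \<bar>y h - w j\<bar> / \<epsilon>) *
        (\<Sum>l<N. exp (- \<bar>x k - z l\<bar> / \<epsilon>) * f l j i)) ` {..<M}) (16 * (N * M))"
proof -
  define T where "T = (\<lambda>k j i. \<Sum>l<N. exp (- \<bar>x k - z l\<bar> / \<epsilon>) * f l j i)"
  have "slp_derives (\<Union>j<M. (\<lambda>l. f l j) ` {..<N}) (\<Union>j<M. (\<lambda>k. T k j) ` {..<N}) (M * (8 * N))"
    unfolding T_def
    by (intro slp_derives_UN slp_derives_mono[OF slp_derives_kernel_1d[OF z] _ subset_refl]) blast
  moreover have "slp_derives (\<Union>j<M. (\<lambda>k. T k j) ` {..<N})
      (\<Union>k<N. (\<lambda>h i. \<Sum>j<M. exp (- \<bar>y h - w j\<bar> / \<epsilon>) * T k j i) ` {..<M}) (N * (8 * M))"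
    by (intro slp_derives_UN slp_derives_mono[OF slp_derives_kernel_1d[OF w, where f = "T _"] _ subset_refl])
      blast
  ultimately have "slp_derives (\<Union>j<M. (\<lambda>l. f l j) ` {..<N})
      (\<Union>k<N. (\<lambda>h i. \<Sum>j<M. exp (- \<bar>y h - w j\<bar> / \<epsilon>) * T k j i) ` {..<M})
      (M * (8 * N) + N * (8 * M))"
    by (rule slp_derives_trans)
  then show ?thesis unfolding T_def by (simp add: algebra_simps)
qed

end

section \<open>The two-dimensional kernel matrix\<close>

text \<open>The range is cut into \<open>M\<close> consecutive blocks of length \<open>N\<close>,
  which in column-major order are the columns.\<close>

lemma sum_lessThan_mult:
  "(\<Sum>q<N * M. g q) = (\<Sum>j<M. \<Sum>l<N. g (j * N + l :: nat))"
proof -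
  have "(\<Sum>j<M. \<Sum>l<N. g (j * N + l)) = (\<Sum>j<M. sum g {j * N..<j * N + N})"
    by (rule sum.cong[OF refl])
      (simp add: sum.atLeastLessThan_shift_0[of g] atLeast0LessThan add.commute)
  also have "\<dots> = (\<Sum>q<M * N. g q)" by (rule sum.nat_group)
  finally show ?thesis by (simp add: mult.commute)
qed

lemma mult_add_less_mult:
  fixes N M :: nat
  assumes "k < N" "j < M"
  shows "j * N + k < N * M"
proof -
  have "j * N + k < Suc j * N" using assms by simp
  also have "\<dots> \<le> M * N" using assms by (intro mult_le_mono1) simp
  finally show ?thesis by (simp add: mult.commute)
qed

lemma kernel_1d_transpose: "(kernel_1d \<epsilon> x1 x2)\<^sup>T = kernel_1d \<epsilon> x2 x1"
  by (rule eq_matI) (auto simp: kernel_1d_def abs_minus_commute)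

lemma kernel_2d_dim [simp]:
  "dim_row (kernel_2d \<epsilon> x1 y1 x2 y2) = dim_vec x1 * dim_vec y1"
  "dim_col (kernel_2d \<epsilon> x1 y1 x2 y2) = dim_vec x2 * dim_vec y2"
  by (simp_all add: kernel_2d_def)

text \<open>Distances are symmetric. Since transposing only exchanges the two grids, products with
  the transpose are instances of the results about products with the kernel.\<close>

lemma kernel_2d_transpose: "(kernel_2d \<epsilon> x1 y1 x2 y2)\<^sup>T = kernel_2d \<epsilon> x2 y2 x1 y1"
  by (rule eq_matI) (auto simp: kernel_2d_def abs_minus_commute)

lemma kernel_2d_eq_kronecker: "kernel_2d \<epsilon> x1 y1 x2 y2 = kernel_1d \<epsilon> y1 y2 \<otimes>\<^sub>K kernel_1d \<epsilon> x1 x2"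
proof (rule eq_matI)
  fix p q
  assume "p < dim_row (kernel_1d \<epsilon> y1 y2 \<otimes>\<^sub>K kernel_1d \<epsilon> x1 x2)"
    "q < dim_col (kernel_1d \<epsilon> y1 y2 \<otimes>\<^sub>K kernel_1d \<epsilon> x1 x2)"
  then have p: "p < dim_vec y1 * dim_vec x1" and q: "q < dim_vec y2 * dim_vec x2"
    by (simp_all add: kronecker_def kernel_1d_def)
  \<comment> \<open>The existence of \<open>p\<close> and \<open>q\<close> forces the divisors to be
    positive.\<close>
  then have "p mod dim_vec x1 < dim_vec x1" "q mod dim_vec x2 < dim_vec x2"
    by (metis mod_less_divisor mult_0_right not_gr_zero not_less_zero)+
  with p q show "kernel_2d \<epsilon> x1 y1 x2 y2 $$ (p, q) =
      (kernel_1d \<epsilon> y1 y2 \<otimes>\<^sub>K kernel_1d \<epsilon> x1 x2) $$ (p, q)"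
    by (simp add: kronecker_def kernel_1d_def kernel_2d_def less_mult_imp_div_less mult.commute
        exp_add[symmetric] diff_divide_distrib)
qed (simp_all add: kronecker_def kernel_1d_def mult.commute)

text \<open>With \<open>q = j * N + l\<close> the kernel entry is a factor in \<open>j\<close> times
  a factor in \<open>l\<close>, so the first leaves the inner sum. The nested form is what the
  column-then-row evaluation computes.\<close>

lemma kernel_2d_mult_vec_index:
  assumes "x1 \<in> carrier_vec N" "x2 \<in> carrier_vec N" "y1 \<in> carrier_vec M" "y2 \<in> carrier_vec M"
    and "\<psi> \<in> carrier_vec (N * M)" "p < N * M"
  shows "(kernel_2d \<epsilon> x1 y1 x2 y2 *\<^sub>v \<psi>) $ p =
    (\<Sum>j<M. exp (- \<bar>y1 $ (p div N) - y2 $ j\<bar> / \<epsilon>) *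
      (\<Sum>l<N. exp (- \<bar>x1 $ (p mod N) - x2 $ l\<bar> / \<epsilon>) * \<psi> $ (j * N + l)))"
proof -
  have "(kernel_2d \<epsilon> x1 y1 x2 y2 *\<^sub>v \<psi>) $ p =
      (\<Sum>q<N * M. kernel_2d \<epsilon> x1 y1 x2 y2 $$ (p, q) * \<psi> $ q)"
    using assms by (simp add: scalar_prod_def atLeast0LessThan)
  also have "\<dots> = (\<Sum>j<M. \<Sum>l<N. kernel_2d \<epsilon> x1 y1 x2 y2 $$ (p, j * N + l) * \<psi> $ (j * N + l))"
    by (rule sum_lessThan_mult)
  also have "\<dots> = (\<Sum>j<M. exp (- \<bar>y1 $ (p div N) - y2 $ j\<bar> / \<epsilon>) *
      (\<Sum>l<N. exp (- \<bar>x1 $ (p mod N) - x2 $ l\<bar> / \<epsilon>) * \<psi> $ (j * N + l)))"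
  proof (intro sum.cong refl)
    fix j assume "j \<in> {..<M}"
    then have "kernel_2d \<epsilon> x1 y1 x2 y2 $$ (p, j * N + l) =
        exp (- \<bar>y1 $ (p div N) - y2 $ j\<bar> / \<epsilon>) * exp (- \<bar>x1 $ (p mod N) - x2 $ l\<bar> / \<epsilon>)"
      if "l < N" for l
      using assms that mult_add_less_mult[of l N j M]
      by (simp add: kernel_2d_def exp_add[symmetric] diff_divide_distrib)
    then show "(\<Sum>l<N. kernel_2d \<epsilon> x1 y1 x2 y2 $$ (p, j * N + l) * \<psi> $ (j * N + l)) =
        exp (- \<bar>y1 $ (p div N) - y2 $ j\<bar> / \<epsilon>) *
        (\<Sum>l<N. exp (- \<bar>x1 $ (p mod N) - x2 $ l\<bar> / \<epsilon>) * \<psi> $ (j * N + l))"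
      by (simp add: sum_distrib_left mult.assoc)
  qed
  finally show ?thesis .
qed

text \<open>Entry by entry, both sides are the same nested sum: \<open>l\<close> is the summation
  index of the left matrix product and \<open>j\<close> that of the product with the transposed
  kernel.\<close>

lemma kernel_2d_mult_vectorize:
  assumes "x1 \<in> carrier_vec N" "x2 \<in> carrier_vec N" "y1 \<in> carrier_vec M" "y2 \<in> carrier_vec M"
    and "\<Psi> \<in> carrier_mat N M"
  shows "kernel_2d \<epsilon> x1 y1 x2 y2 *\<^sub>v vectorize \<Psi> =
    vectorize ((kernel_1d \<epsilon> x1 x2 * \<Psi>) * (kernel_1d \<epsilon> y1 y2)\<^sup>T)"
proof (rule eq_vecI)
  fix p
  assume "p < dim_vec (vectorize ((kernel_1d \<epsilon> x1 x2 * \<Psi>) * (kernel_1d \<epsilon> y1 y2)\<^sup>T))"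
  then have p: "p < N * M" using assms by (simp add: vectorize_def kernel_1d_def)
  then have pN: "p mod N < N" "p div N < M"
    by (metis mod_less_divisor mult_0 not_gr_zero not_less_zero)
      (use p in \<open>simp add: less_mult_imp_div_less mult.commute\<close>)
  have entry: "vectorize \<Psi> $ (j * N + l) = \<Psi> $$ (l, j)" if "j < M" "l < N" for j l
    using assms that mult_add_less_mult[of l N j M] by (simp add: vectorize_def)
  have "vectorize \<Psi> \<in> carrier_vec (N * M)" using assms by (auto simp: vectorize_def)
  from kernel_2d_mult_vec_index[OF assms(1-4) this p]
  show "(kernel_2d \<epsilon> x1 y1 x2 y2 *\<^sub>v vectorize \<Psi>) $ p =
      vectorize ((kernel_1d \<epsilon> x1 x2 * \<Psi>) * (kernel_1d \<epsilon> y1 y2)\<^sup>T) $ p"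
    using assms p pN
    by (simp add: vectorize_def[of "_ * _"] kernel_1d_def scalar_prod_def atLeast0LessThan entry mult.commute)
qed (use assms in \<open>simp add: vectorize_def kernel_1d_def\<close>)

section \<open>Straight-line programs for the two-dimensional kernel\<close>

text \<open>The vector \<open>w i\<close> may be any quantity depending on the index, not just the
  input, so that the result also applies to intermediate vectors of the Sinkhorn iteration. The cuts
  are made in \<open>x2\<close> and \<open>y2\<close>, the grids that are summed over.\<close>

lemma slp_derives_kernel_2d:
  assumes "x1 \<in> carrier_vec N" "x2 \<in> carrier_vec N" "y1 \<in> carrier_vec M" "y2 \<in> carrier_vec M"
    and "strictly_increasing x2" "strictly_increasing y2"
    and w: "\<And>i. i \<in> X \<Longrightarrow> w i \<in> carrier_vec (N * M)"
  shows "slp_derives X inp ((\<lambda>p i. w i $ p) ` {..<N * M})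
    ((\<lambda>p i. (kernel_2d \<epsilon> x1 y1 x2 y2 *\<^sub>v w i) $ p) ` {..<N * M}) (16 * (N * M))"
\<comment> \<open>Positions \<open>p\<close> are matched with pairs \<open>(l, j)\<close>. The
  nested-sum formula for the output holds for indices in \<open>X\<close>, where \<open>w i\<close>
  has the right dimension, so agreement on \<open>X\<close> is what can be shown.\<close>
proof (rule slp_derives_cong)
  have "strict_mono_on {..<N} (\<lambda>k. x2 $ k)" "strict_mono_on {..<M} (\<lambda>k. y2 $ k)"
    using assms by (auto simp: strictly_increasing_def)
  from slp_derives_kernel_2d_entries[OF this]
  show "slp_derives X inp (\<Union>j<M. (\<lambda>l i. w i $ (j * N + l)) ` {..<N})
    (\<Union>k<N. (\<lambda>h i. \<Sum>j<M. exp (- \<bar>y1 $ h - y2 $ j\<bar> / \<epsilon>) *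
        (\<Sum>l<N. exp (- \<bar>x1 $ k - x2 $ l\<bar> / \<epsilon>) * w i $ (j * N + l))) ` {..<M}) (16 * (N * M))" .
next
  fix f assume "f \<in> (\<Union>j<M. (\<lambda>l i. w i $ (j * N + l)) ` {..<N})"
  then obtain j l where "j < M" "l < N" and f: "f = (\<lambda>i. w i $ (j * N + l))" by auto
  then have "j * N + l \<in> {..<N * M}" using mult_add_less_mult by simp
  then have "f \<in> (\<lambda>p i. w i $ p) ` {..<N * M}" by (rule rev_image_eqI) (rule f)
  then show "\<exists>f'\<in>(\<lambda>p i. w i $ p) ` {..<N * M}. \<forall>i\<in>X. f i = f' i"
    by (intro bexI[of _ f]) simp_all
next
  fix g assume "g \<in> (\<lambda>p i. (kernel_2d \<epsilon> x1 y1 x2 y2 *\<^sub>v w i) $ p) ` {..<N * M}"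
  then obtain p where p: "p < N * M" and g: "g = (\<lambda>i. (kernel_2d \<epsilon> x1 y1 x2 y2 *\<^sub>v w i) $ p)"
    by auto
  have pN: "p mod N < N" "p div N < M"
    by (metis p mod_less_divisor mult_0 not_gr_zero not_less_zero)
      (use p in \<open>simp add: less_mult_imp_div_less mult.commute\<close>)
  let ?g = "\<lambda>i. \<Sum>j<M. exp (- \<bar>y1 $ (p div N) - y2 $ j\<bar> / \<epsilon>) *
        (\<Sum>l<N. exp (- \<bar>x1 $ (p mod N) - x2 $ l\<bar> / \<epsilon>) * w i $ (j * N + l))"
  have "\<forall>i\<in>X. g i = ?g i"
    using kernel_2d_mult_vec_index[OF assms(1-4) w p] unfolding g by blast
  moreover have "?g \<in> (\<Union>k<N. (\<lambda>h i. \<Sum>j<M. exp (- \<bar>y1 $ h - y2 $ j\<bar> / \<epsilon>) *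
        (\<Sum>l<N. exp (- \<bar>x1 $ k - x2 $ l\<bar> / \<epsilon>) * w i $ (j * N + l))) ` {..<M})"
    by (rule UN_I[of "p mod N"], simp add: pN, rule rev_image_eqI[of "p div N"]) (simp_all add: pN)
  ultimately show "\<exists>g'\<in>\<Union>k<N. (\<lambda>h i. \<Sum>j<M. exp (- \<bar>y1 $ h - y2 $ j\<bar> / \<epsilon>) *
        (\<Sum>l<N. exp (- \<bar>x1 $ k - x2 $ l\<bar> / \<epsilon>) * w i $ (j * N + l))) ` {..<M}.
      \<forall>i\<in>X. g i = g' i"
    by (intro bexI[of _ ?g])
qed

lemma list_of_vec_conv_map: "list_of_vec v = map (($) v) [0..<dim_vec v]"
  by (rule nth_equalityI) (simp_all add: list_of_vec_index)

lemma kernel_2d_slp: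
  assumes "x1 \<in> carrier_vec N" "x2 \<in> carrier_vec N" "y1 \<in> carrier_vec M" "y2 \<in> carrier_vec M"
    and "strictly_increasing x2" "strictly_increasing y2"
  shows "\<exists>P. real (slp_cost P) \<le> 16 * real (N * M) \<and> (\<forall>\<psi> \<in> carrier_vec (N * M).
    slp_eval P (list_of_vec \<psi>) = Some (list_of_vec (kernel_2d \<epsilon> x1 y1 x2 y2 *\<^sub>v \<psi>)))"
proof -
  \<comment> \<open>Every input vector serves as its own index, so that reachability over
    \<open>?X\<close> yields one program for all vectors.\<close>
  let ?X = "carrier_vec (N * M) :: real vec set" and ?K = "kernel_2d \<epsilon> x1 y1 x2 y2"
  have "slp_reaches ?X list_of_vec ((\<lambda>p i. list_of_vec i ! p) ` {..<N * M}) 0"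
    by (rule slp_reaches_inputs) simp
  then have "slp_reaches ?X list_of_vec ((\<lambda>p i. i $ p) ` {..<N * M}) 0"
    by (rule slp_reaches_cong) (auto simp: list_of_vec_index)
  then have "slp_reaches ?X list_of_vec ((\<lambda>p i. i $ p) ` {..<N * M} \<union>
      (\<lambda>p i. (?K *\<^sub>v i) $ p) ` {..<N * M}) (0 + 16 * (N * M))"
    using slp_derives_kernel_2d[OF assms, of ?X "\<lambda>i. i" list_of_vec \<epsilon>]
    unfolding slp_derives_def by blast
  then obtain P where cost: "slp_cost P \<le> 0 + 16 * (N * M)" and eval:
    "\<And>i. i \<in> ?X \<Longrightarrow> slp_eval P (list_of_vec i) =
      Some (map (\<lambda>f. f i) (map (\<lambda>p i. (?K *\<^sub>v i) $ p) [0..<N * M]))"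
    by (rule slp_reaches_eval[where fs = "map (\<lambda>p i. (?K *\<^sub>v i) $ p) [0..<N * M]"]) auto
  have "real (slp_cost P) \<le> 16 * real (N * M)"
    using of_nat_mono[OF cost, where 'a = real] by simp
  then show ?thesis using assms eval
    by (intro exI[of _ P]) (auto simp: list_of_vec_conv_map[of "_ *\<^sub>v _"] comp_def)
qed

section \<open>Sinkhorn iteration\<close>

text \<open>One division per entry; a nonzero denominator at every index in \<open>X\<close> is what
  makes the instruction defined.\<close>

lemma slp_derives_vec_divide:
  assumes "\<And>i. i \<in> X \<Longrightarrow> dim_vec (b i) = n"
    and "\<And>i p. i \<in> X \<Longrightarrow> p < n \<Longrightarrow> b i $ p \<noteq> 0"
  shows "slp_derives X inp ((\<lambda>p i. a i $ p) ` {..<n} \<union> (\<lambda>p i. b i $ p) ` {..<n})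
    ((\<lambda>p i. (a i \<oslash> b i) $ p) ` {..<n}) n"
proof -
  have "slp_derives X inp ((\<lambda>p i. a i $ p) ` {..<n} \<union> (\<lambda>p i. b i $ p) ` {..<n})
      {\<lambda>i. (a i \<oslash> b i) $ p} 1" if "p < n" for p
    by (rule slp_derives_mono[OF slp_derives_op[where opn = Divide and f = "\<lambda>i. a i $ p"
            and g = "\<lambda>i. b i $ p"]])
      (use assms that in \<open>auto simp: vec_divide_def\<close>)
  from slp_derives_image[OF this] show ?thesis by simp
qed

text \<open>Two kernel products at \<open>16 * (N * M)\<close> and two entrywise divisions at
  \<open>N * M\<close> add up to \<open>34 * (N * M)\<close>. The second product uses the vector
  \<open>\<psi>\<close> just computed.\<close>

lemma sinkhorn_slp:
  fixes \<epsilon> :: real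
  assumes "x1 \<in> carrier_vec N" "x2 \<in> carrier_vec N" "y1 \<in> carrier_vec M" "y2 \<in> carrier_vec M"
    and "strictly_increasing x1" "strictly_increasing x2"
    and "strictly_increasing y1" "strictly_increasing y2"
  defines "K \<equiv> kernel_2d \<epsilon> x1 y1 x2 y2"
  shows "\<exists>P. real (slp_cost P) \<le> 34 * real (N * M) \<and>
    (\<forall>u \<in> carrier_mat N M. \<forall>v \<in> carrier_mat N M. \<forall>\<phi> \<in> carrier_vec (N * M).
      sinkhorn_defined K v \<phi> \<longrightarrow>
      slp_eval P (list_of_vec (vectorize u) @ list_of_vec (vectorize v) @ list_of_vec \<phi>) =
        Some (list_of_vec (sinkhorn_psi K v \<phi>) @
              list_of_vec (sinkhorn_phi K u (sinkhorn_psi K v \<phi>))))"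
proof -
  let ?n = "N * M"
  \<comment> \<open>Definedness of the iteration is built into the index set, so that no division of
    the program fails at any index.\<close>
  define X :: "(real mat \<times> real mat \<times> real vec) set" where "X = {(u, v, \<phi>). u \<in> carrier_mat N M \<and> v \<in> carrier_mat N M \<and>
    \<phi> \<in> carrier_vec ?n \<and> sinkhorn_defined K v \<phi>}"
  define U :: "real mat \<times> real mat \<times> real vec \<Rightarrow> real vec" where "U = (\<lambda>(u, v, \<phi>). vectorize u)"
  define V :: "real mat \<times> real mat \<times> real vec \<Rightarrow> real vec" where "V = (\<lambda>(u, v, \<phi>). vectorize v)"
  define W :: "real mat \<times> real mat \<times> real vec \<Rightarrow> real vec" where "W = (\<lambda>(u, v, \<phi>). \<phi>)"
  define inp where "inp = (\<lambda>i. list_of_vec (U i) @ list_of_vec (V i) @ list_of_vec (W i))"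
  define psi where "psi = (\<lambda>i. V i \<oslash> (K\<^sup>T *\<^sub>v W i))"
  define phi where "phi = (\<lambda>i. U i \<oslash> (K *\<^sub>v psi i))"
  define E :: "(real mat \<times> real mat \<times> real vec \<Rightarrow> real vec) \<Rightarrow> _ set"
    where "E = (\<lambda>w. (\<lambda>p i. w i $ p) ` {..<?n})"
  have dimK: "dim_row K = ?n" "dim_col K = ?n" using assms by (auto simp: K_def)
  have dims: "dim_vec (U i) = ?n" "dim_vec (V i) = ?n" "dim_vec (W i) = ?n" if "i \<in> X" for i
    using that by (auto simp: X_def U_def V_def W_def vectorize_def)
  have dimpsi: "dim_vec (psi i) = ?n" and dimphi: "dim_vec (phi i) = ?n" for i
    by (simp_all add: psi_def phi_def vec_divide_def dimK)
  have defd: "(K\<^sup>T *\<^sub>v W i) $ p \<noteq> 0" "(K *\<^sub>v psi i) $ p \<noteq> 0" if "i \<in> X" "p < ?n" for i p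
    using that dimK
    by (auto simp: X_def W_def V_def psi_def sinkhorn_defined_def sinkhorn_psi_def)

  have "slp_reaches X inp ((\<lambda>p i. inp i ! p) ` {..<3 * ?n}) 0"
    by (rule slp_reaches_inputs) (use dims in \<open>simp add: inp_def\<close>)
  then have input: "slp_reaches X inp (E U \<union> E V \<union> E W) 0"
  proof (rule slp_reaches_cong)
    fix g assume "g \<in> E U \<union> E V \<union> E W"
    then consider p where "p < ?n" "g = (\<lambda>i. U i $ p)" | p where "p < ?n" "g = (\<lambda>i. V i $ p)"
      | p where "p < ?n" "g = (\<lambda>i. W i $ p)"
      unfolding E_def by auto
    \<comment> \<open>The input concatenates three blocks of length \<open>?n\<close>, so the
      entries of \<open>U\<close>, \<open>V\<close> and \<open>W\<close> sit at offsets
      \<open>0\<close>, \<open>?n\<close> and \<open>?n + ?n\<close>.\<close>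
    then have "\<exists>q<3 * ?n. \<forall>i\<in>X. g i = inp i ! q"
    proof cases
      case 1
      then show ?thesis using dims
        by (intro exI[of _ p] conjI ballI)
          (linarith, simp add: inp_def nth_append list_of_vec_index)
    next
      case 2
      then show ?thesis using dims
        by (intro exI[of _ "?n + p"] conjI ballI)
          (linarith, simp add: inp_def nth_append list_of_vec_index)
    next
      case 3
      then show ?thesis using dims
        by (intro exI[of _ "?n + (?n + p)"] conjI ballI)
          (linarith, simp add: inp_def nth_append list_of_vec_index)
    qed
    then show "\<exists>f\<in>(\<lambda>p i. inp i ! p) ` {..<3 * ?n}. \<forall>i\<in>X. g i = f i" by auto
  qed

  \<comment> \<open>The transpose is the kernel with exchanged grids, so here the cuts are made in
    \<open>x1\<close> and \<open>y1\<close>.\<close>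
  have psi1: "slp_derives X inp (E W) (E (\<lambda>i. K\<^sup>T *\<^sub>v W i)) (16 * ?n)"
    unfolding E_def K_def kernel_2d_transpose
    by (rule slp_derives_kernel_2d[OF assms(2,1,4,3,5,7)]) (rule carrier_vecI, rule dims(3))
  have psi2: "slp_derives X inp (E V \<union> E (\<lambda>i. K\<^sup>T *\<^sub>v W i)) (E psi) ?n"
    unfolding E_def psi_def by (rule slp_derives_vec_divide) (simp add: dimK, rule defd(1))
  have phi1: "slp_derives X inp (E psi) (E (\<lambda>i. K *\<^sub>v psi i)) (16 * ?n)"
    unfolding E_def K_def
    by (rule slp_derives_kernel_2d[OF assms(1-4,6,8)]) (rule carrier_vecI, rule dimpsi)
  have phi2: "slp_derives X inp (E U \<union> E (\<lambda>i. K *\<^sub>v psi i)) (E phi) ?n"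
    unfolding E_def phi_def by (rule slp_derives_vec_divide) (simp add: dimK, rule defd(2))
  have "slp_derives X inp (E U \<union> E V \<union> E W)
    (E (\<lambda>i. K\<^sup>T *\<^sub>v W i) \<union> E psi \<union> E (\<lambda>i. K *\<^sub>v psi i) \<union> E phi) (16 * ?n + ?n + 16 * ?n + ?n)"
    by (rule slp_derives_comp[OF slp_derives_comp[OF slp_derives_comp[OF
            slp_derives_mono[OF psi1 _ subset_refl] psi2] phi1] phi2]) auto
  from this[unfolded slp_derives_def, rule_format, OF subset_refl input] have "slp_reaches X inp (E U \<union> E V \<union> E W \<union>
    (E (\<lambda>i. K\<^sup>T *\<^sub>v W i) \<union> E psi \<union> E (\<lambda>i. K *\<^sub>v psi i) \<union> E phi)) (0 + (16 * ?n + ?n + 16 * ?n + ?n))" .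
  then obtain P where cost: "slp_cost P \<le> 0 + (16 * ?n + ?n + 16 * ?n + ?n)" and
    eval: "\<And>i. i \<in> X \<Longrightarrow> slp_eval P (inp i) =
      Some (map (\<lambda>f. f i) (map (\<lambda>p i. psi i $ p) [0..<?n] @ map (\<lambda>p i. phi i $ p) [0..<?n]))"
    by (rule slp_reaches_eval[where
          fs = "map (\<lambda>p i. psi i $ p) [0..<?n] @ map (\<lambda>p i. phi i $ p) [0..<?n]"])
      (auto simp: E_def)
  have eval': "slp_eval P (inp i) = Some (list_of_vec (psi i) @ list_of_vec (phi i))" if "i \<in> X" for i
    using eval[OF that] by (simp add: list_of_vec_conv_map dimpsi dimphi comp_def)
  show ?thesis
  proof (intro exI[of _ P] conjI ballI impI)
    fix u v :: "real mat" and \<phi> :: "real vec"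
    assume "u \<in> carrier_mat N M" "v \<in> carrier_mat N M" "\<phi> \<in> carrier_vec ?n" "sinkhorn_defined K v \<phi>"
    then have "(u, v, \<phi>) \<in> X" by (simp add: X_def)
    from eval'[OF this]
    show "slp_eval P (list_of_vec (vectorize u) @ list_of_vec (vectorize v) @ list_of_vec \<phi>) =
        Some (list_of_vec (sinkhorn_psi K v \<phi>) @
              list_of_vec (sinkhorn_phi K u (sinkhorn_psi K v \<phi>)))"
      by (simp add: inp_def psi_def phi_def U_def V_def W_def sinkhorn_psi_def sinkhorn_phi_def)
  next
    show "real (slp_cost P) \<le> 34 * real ?n"
      using of_nat_mono[OF cost, where 'a = real] by (simp add: mult.commute)
  qed
qed

section \<open>Factorization, fast products and the cost of a Sinkhorn iteration combined\<close>

theorem mainTheorem4: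
  shows "\<exists>c C :: real. c > 0 \<and> C > 0 \<and>
    (\<forall>(N::nat) (M::nat) (\<epsilon>::real) (x1::real vec) (x2::real vec) (y1::real vec) (y2::real vec).
      N \<ge> 1 \<longrightarrow> M \<ge> 1 \<longrightarrow> \<epsilon> > 0 \<longrightarrow>
      x1 \<in> carrier_vec N \<longrightarrow> x2 \<in> carrier_vec N \<longrightarrow>
      y1 \<in> carrier_vec M \<longrightarrow> y2 \<in> carrier_vec M \<longrightarrow>
      strictly_increasing x1 \<longrightarrow> strictly_increasing x2 \<longrightarrow>
      strictly_increasing y1 \<longrightarrow> strictly_increasing y2 \<longrightarrow>
      (let K = kernel_2d \<epsilon> x1 y1 x2 y2; Kx = kernel_1d \<epsilon> x1 x2; Ky = kernel_1d \<epsilon> y1 y2 in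
        K = Ky \<otimes>\<^sub>K Kx \<and>
        (\<forall>\<Psi> \<in> carrier_mat N M. K *\<^sub>v vectorize \<Psi> = vectorize ((Kx * \<Psi>) * Ky\<^sup>T)) \<and>
        (\<forall>\<Phi> \<in> carrier_mat N M. K\<^sup>T *\<^sub>v vectorize \<Phi> = vectorize ((Kx\<^sup>T * \<Phi>) * Ky)) \<and>
        (\<exists>P. real (slp_cost P) \<le> c * real (N * M) \<and>
          (\<forall>\<psi> \<in> carrier_vec (N * M).
            slp_eval P (list_of_vec \<psi>) = Some (list_of_vec (K *\<^sub>v \<psi>)))) \<and>
        (\<exists>P. real (slp_cost P) \<le> c * real (N * M) \<and>
          (\<forall>\<phi> \<in> carrier_vec (N * M).
            slp_eval P (list_of_vec \<phi>) = Some (list_of_vec (K\<^sup>T *\<^sub>v \<phi>)))) \<and>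
        (\<exists>P. real (slp_cost P) \<le> C * real (N * M) \<and>
          (\<forall>u \<in> carrier_mat N M. \<forall>v \<in> carrier_mat N M. \<forall>\<phi> \<in> carrier_vec (N * M).
            sinkhorn_defined K v \<phi> \<longrightarrow>
            slp_eval P (list_of_vec (vectorize u) @ list_of_vec (vectorize v) @ list_of_vec \<phi>) =
              Some (list_of_vec (sinkhorn_psi K v \<phi>) @
                    list_of_vec (sinkhorn_phi K u (sinkhorn_psi K v \<phi>)))))))"
\<comment> \<open>The first constant is 8 for the products along columns plus 8 for those along
  rows; the second is 16 + 1 for each of the two updates.\<close>
proof (rule exI[of _ 16], rule exI[of _ 34], intro conjI allI impI)
  fix N M :: nat and \<epsilon> :: real and x1 x2 y1 y2 :: "real vec"
  assume x1: "x1 \<in> carrier_vec N" and x2: "x2 \<in> carrier_vec N"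
    and y1: "y1 \<in> carrier_vec M" and y2: "y2 \<in> carrier_vec M"
    and inc: "strictly_increasing x1" "strictly_increasing x2"
      "strictly_increasing y1" "strictly_increasing y2"
  show "let K = kernel_2d \<epsilon> x1 y1 x2 y2; Kx = kernel_1d \<epsilon> x1 x2; Ky = kernel_1d \<epsilon> y1 y2 in
        K = Ky \<otimes>\<^sub>K Kx \<and>
        (\<forall>\<Psi> \<in> carrier_mat N M. K *\<^sub>v vectorize \<Psi> = vectorize ((Kx * \<Psi>) * Ky\<^sup>T)) \<and>
        (\<forall>\<Phi> \<in> carrier_mat N M. K\<^sup>T *\<^sub>v vectorize \<Phi> = vectorize ((Kx\<^sup>T * \<Phi>) * Ky)) \<and>
        (\<exists>P. real (slp_cost P) \<le> 16 * real (N * M) \<and>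
          (\<forall>\<psi> \<in> carrier_vec (N * M).
            slp_eval P (list_of_vec \<psi>) = Some (list_of_vec (K *\<^sub>v \<psi>)))) \<and>
        (\<exists>P. real (slp_cost P) \<le> 16 * real (N * M) \<and>
          (\<forall>\<phi> \<in> carrier_vec (N * M).
            slp_eval P (list_of_vec \<phi>) = Some (list_of_vec (K\<^sup>T *\<^sub>v \<phi>)))) \<and>
        (\<exists>P. real (slp_cost P) \<le> 34 * real (N * M) \<and>
          (\<forall>u \<in> carrier_mat N M. \<forall>v \<in> carrier_mat N M. \<forall>\<phi> \<in> carrier_vec (N * M).
            sinkhorn_defined K v \<phi> \<longrightarrow>
            slp_eval P (list_of_vec (vectorize u) @ list_of_vec (vectorize v) @ list_of_vec \<phi>) =
              Some (list_of_vec (sinkhorn_psi K v \<phi>) @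
                    list_of_vec (sinkhorn_phi K u (sinkhorn_psi K v \<phi>)))))"
    unfolding Let_def
  proof (intro conjI ballI)
    show "kernel_2d \<epsilon> x1 y1 x2 y2 = kernel_1d \<epsilon> y1 y2 \<otimes>\<^sub>K kernel_1d \<epsilon> x1 x2"
      by (rule kernel_2d_eq_kronecker)
  next
    fix \<Psi> :: "real mat" assume "\<Psi> \<in> carrier_mat N M"
    then show "kernel_2d \<epsilon> x1 y1 x2 y2 *\<^sub>v vectorize \<Psi> =
        vectorize ((kernel_1d \<epsilon> x1 x2 * \<Psi>) * (kernel_1d \<epsilon> y1 y2)\<^sup>T)"
      by (rule kernel_2d_mult_vectorize[OF x1 x2 y1 y2])
  next
    fix \<Phi> :: "real mat" assume "\<Phi> \<in> carrier_mat N M"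
    \<comment> \<open>With the grids exchanged, the right factor is the transpose of
      \<open>kernel_1d \<epsilon> y2 y1\<close>, which is \<open>kernel_1d \<epsilon> y1 y2\<close>
      again.\<close>
    from kernel_2d_mult_vectorize[OF x2 x1 y2 y1 this]
    show "(kernel_2d \<epsilon> x1 y1 x2 y2)\<^sup>T *\<^sub>v vectorize \<Phi> =
        vectorize (((kernel_1d \<epsilon> x1 x2)\<^sup>T * \<Phi>) * kernel_1d \<epsilon> y1 y2)"
      by (simp add: kernel_1d_transpose kernel_2d_transpose)
  qed (unfold kernel_2d_transpose, rule kernel_2d_slp[OF x1 x2 y1 y2 inc(2,4)],
      rule kernel_2d_slp[OF x2 x1 y2 y1 inc(1,3)], rule sinkhorn_slp[OF x1 x2 y1 y2 inc])
qed simp_all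

end
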